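(* Let $q$ be a prime power, let $n$ be an even integer, and let $k,l$ be integers with $k,l\le q^{n/2}$. Then \[ \mathrm{La}_{q}(n,\{\mathrm{V}_{k},\Lambda_{l}\}) = \begin{bmatrix} n\\ n/2\end{bmatrix}_q, \] and the only $\{\mathrm{V}_k,\Lambda_l\}$-free family of subspaces of an $n$-dimensional vector space $V$ over $\mathbb{F}_q$ of maximum size is the set of all $n/2$-dimensional subspaces of $V$.
   Context: Subspaces are ordered by inclusion. A poset $P$ is a subposet of a poset $Q$ if there is an injection $\phi:P\to Q$ with $x\le_P y\Rightarrow\phi(x)\le_Q\phi(y)$; a family is $\mathcal{P}$-free if it contains no member of $\mathcal{P}$ as a subposet. $\mathrm{V}_k$ is the poset with elements $x_1,\dots,x_k,y$ where $x_1,\dots,x_k>y$ (and no other relations), and $\Lambda_k$ is the same poset with all relations reversed. $\mathrm{La}_q(n,\mathcal{P})$ is the maximum size of a $\mathcal{P}$-free family of subspaces of an $n$-dimensional vector space over $\mathbb{F}_q$. $\begin{bmatrix} n\\ k\end{bmatrix}_q=\prod_{0\le i<k}\frac{q^{n-i}-1}{q^{k-i}-1}$. *)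

theory Defs
  imports Complex_Main "HOL-Library.Cardinality" "HOL-Number_Theory.Prime_Powers"
begin

text \<open>
  A poset is represented by its order relation \<open>r\<close>, with \<open>(a, b) \<in> r\<close> read as \<open>a \<le> b\<close>.
  As \<open>r\<close> is reflexive on its ground set, the ground set is \<^term>\<open>Field r\<close>.

  Following the usage in extremal poset theory, a subposet need not be induced:
  the embedding preserves the order but does not have to reflect it.
\<close>

definition subposet :: "'a rel \<Rightarrow> 'b rel \<Rightarrow> bool" where
  "subposet P Q \<longleftrightarrow>
     (\<exists>\<phi>. inj_on \<phi> (Field P) \<and> \<phi> ` Field P \<subseteq> Field Q \<and> (\<forall>(x, y) \<in> P. (\<phi> x, \<phi> y) \<in> Q))"

definition poset_free :: "'a rel set \<Rightarrow> 'b set set \<Rightarrow> bool" where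
  "poset_free \<P> F \<longleftrightarrow> \<not> (\<exists>P \<in> \<P>. subposet P (relation_of (\<subseteq>) F))"

text \<open>The element \<open>y\<close> of the poset is \<open>0\<close>, and \<open>x\<^sub>i\<close> is \<open>i\<close> for \<open>1 \<le> i \<le> k\<close>.\<close>

definition V_poset :: "nat \<Rightarrow> nat rel" where
  "V_poset k = relation_of (\<lambda>a b. a = b \<or> a = 0) {0..k}"

definition Lambda_poset :: "nat \<Rightarrow> nat rel" where
  "Lambda_poset k = (V_poset k)\<inverse>"

lemma Field_V_poset: "Field (V_poset k) = {0..k}"
  by (auto simp: V_poset_def relation_of_def Field_def)

lemma Partial_order_V_poset: "Partial_order (V_poset k)"
  unfolding order_on_defs Field_V_poset
  by (auto simp: V_poset_def relation_of_def intro!: refl_onI transI antisymI)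

lemma Field_Lambda_poset: "Field (Lambda_poset k) = {0..k}"
  by (simp add: Lambda_poset_def Field_V_poset)

lemma Partial_order_Lambda_poset: "Partial_order (Lambda_poset k)"
  using Partial_order_V_poset by (simp add: Lambda_poset_def)

definition free_subspace_family ::
    "('k::field \<Rightarrow> 'v::ab_group_add \<Rightarrow> 'v) \<Rightarrow> 'a rel set \<Rightarrow> 'v set set \<Rightarrow> bool" where
  "free_subspace_family scale \<P> F \<longleftrightarrow> (\<forall>U \<in> F. module.subspace scale U) \<and> poset_free \<P> F"

text \<open>
  The extremal number is attached to a vector space, given by its scalar multiplication, rather
  than to the order of the field and the dimension; isomorphic spaces have the same one.
  Over a finite field and in finite dimension there are finitely many subspaces, so the maximum
  exists as soon as some family is free (for instance the empty one, when all forbidden posets are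
  nonempty).
\<close>

definition La :: "('k::field \<Rightarrow> 'v::ab_group_add \<Rightarrow> 'v) \<Rightarrow> 'a rel set \<Rightarrow> nat" where
  "La scale \<P> = Max {card F |F. free_subspace_family scale \<P> F}"

definition gaussian_binomial :: "nat \<Rightarrow> nat \<Rightarrow> nat \<Rightarrow> real" where
  "gaussian_binomial q n k =
     (\<Prod>i<k. (real q ^ (n - i) - 1) / (real q ^ (k - i) - 1))"

end

theory Submission
  imports Defs
begin

text \<open>
  The lowest level of the family is repeatedly replaced by an equally large set of subspaces one
  dimension higher, until only dimensions at least \<open>n/2\<close> remain; then the same is done downwards
  from the top. A subspace of dimension \<open>i < n/2\<close> has at least \<open>1 + q + \<dots> + q\<^bsup>n/2\<^esup>\<close> upper covers,
  fewer than \<open>k \<le> q\<^bsup>n/2\<^esup>\<close> of them in the family, whereas a subspace of dimension at most \<open>n/2\<close>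
  has at most \<open>1 + q + \<dots> + q\<^bsup>n/2-1\<^esup>\<close> lower covers. Hence Hall's condition holds, with strict
  inequality, for moving the lowest level injectively to upper covers outside the family. As every
  subspace is moved to a larger one, the numbers of members above and below a given member do not
  exceed the old bounds, so both conditions survive. The strict inequality leaves a gap in the
  middle level whenever something was moved, which gives uniqueness.
\<close>

section \<open>Hall's theorem\<close>

text \<open>Induction on the size of \<open>I\<close>. If a proper nonempty \<open>J\<close> has
  exactly \<open>card J\<close> neighbours, then \<open>J\<close> and \<open>I - J\<close> can be
  matched separately. Otherwise every proper nonempty subset has a spare neighbour, and one pair may
  be fixed arbitrarily.\<close>

lemma hall_marriage:
  assumes "finite I" and "\<And>i. i \<in> I \<Longrightarrow> finite (A i)"
    and "\<And>J. J \<subseteq> I \<Longrightarrow> card J \<le> card (\<Union>(A ` J))"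
  shows "\<exists>f. inj_on f I \<and> (\<forall>i\<in>I. f i \<in> A i)"
  using assms
proof (induction "card I" arbitrary: I A rule: less_induct)
  case less
  note fin = \<open>finite I\<close> and finA = less.prems(2) and hall = less.prems(3)
  consider "I = {}"
    | (tight) J where "J \<subset> I" "J \<noteq> {}" "card (\<Union>(A ` J)) = card J"
    | (loose) "I \<noteq> {}" "\<And>J. J \<subset> I \<Longrightarrow> J \<noteq> {} \<Longrightarrow> card J < card (\<Union>(A ` J))"
    using hall by (metis le_neq_implies_less psubset_imp_subset)
  then show ?case
  proof cases
    case 1
    then show ?thesis by simp
  next
    case tight
    let ?T = "\<Union>(A ` J)"
    have finJ: "finite J" using tight(1) fin by (meson psubset_imp_subset finite_subset)
    then have finT: "finite ?T" using tight(1) finA by auto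
    have "card J < card I" using fin tight(1) by (rule psubset_card_mono)
    then obtain f where f: "inj_on f J" "\<forall>i\<in>J. f i \<in> A i"
      using less.hyps[of J A] finJ finA hall tight(1)
      by (metis psubset_imp_subset subset_trans subsetD)
    \<comment> \<open>Hall's condition for \<open>K \<union> J\<close> survives the removal of
      \<open>?T\<close>, because tightness makes the loss exactly \<open>card J\<close>.\<close>
    have hall': "card K \<le> card (\<Union>i\<in>K. A i - ?T)" if K: "K \<subseteq> I - J" for K
    proof -
      have finK: "finite K" using K fin by (meson finite_Diff finite_subset)
      have finU: "finite (\<Union>i\<in>K. A i - ?T)" using finK K finA by auto
      have "card K + card J = card (K \<union> J)"
        using K finK finJ by (intro card_Un_disjoint[symmetric]) auto
      also have "\<dots> \<le> card (\<Union>(A ` (K \<union> J)))" using K tight(1) by (intro hall) auto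
      also have "\<Union>(A ` (K \<union> J)) = (\<Union>i\<in>K. A i - ?T) \<union> ?T" by auto
      also have "card \<dots> = card (\<Union>i\<in>K. A i - ?T) + card ?T"
        using finU finT by (intro card_Un_disjoint) auto
      finally show ?thesis using tight(3) by simp
    qed
    have "card (I - J) < card I"
      using fin tight(1,2) by (intro psubset_card_mono) auto
    then obtain g where g: "inj_on g (I - J)" "\<forall>i\<in>I - J. g i \<in> A i - ?T"
      using less.hyps[of "I - J" "\<lambda>i. A i - ?T"] fin finA hall' by auto
    have "inj_on (\<lambda>i. if i \<in> J then f i else g i) I"
      using f g unfolding inj_on_def by (smt (verit) DiffD2 DiffI UN_I)
    with f g show ?thesis by (intro exI[of _ "\<lambda>i. if i \<in> J then f i else g i"]) auto
  next
    case loose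
    then obtain a where a: "a \<in> I" by blast
    have "A a \<noteq> {}" using hall[of "{a}"] a by auto
    then obtain b where b: "b \<in> A a" by blast
    \<comment> \<open>Deleting \<open>b\<close> costs at most one neighbour, which the strict
      inequality absorbs.\<close>
    have hall': "card K \<le> card (\<Union>i\<in>K. A i - {b})" if K: "K \<subseteq> I - {a}" for K
    proof (cases "K = {}")
      case False
      have "K \<subset> I" using K a by blast
      then have "card K < card (\<Union>(A ` K))" using False by (rule loose(2))
      moreover have "card (\<Union>(A ` K)) - 1 \<le> card (\<Union>(A ` K) - {b})"
        using diff_card_le_card_Diff[of "{b}" "\<Union>(A ` K)"] by simp
      moreover have "(\<Union>i\<in>K. A i - {b}) = \<Union>(A ` K) - {b}" by auto
      ultimately show ?thesis by (metis Suc_diff_1 le_trans less_Suc_eq_le not_less_zero gr0I)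
    qed simp
    have "card (I - {a}) < card I" using fin a by (intro psubset_card_mono) auto
    then obtain g where g: "inj_on g (I - {a})" "\<forall>i\<in>I - {a}. g i \<in> A i - {b}"
      using less.hyps[of "I - {a}" "\<lambda>i. A i - {b}"] fin finA hall' by auto
    have "inj_on (g(a := b)) I"
      using g by (auto simp: inj_on_def)
    with g b show ?thesis by (intro exI[of _ "g(a := b)"]) auto
  qed
qed

section \<open>Double counting and matchings from degree bounds\<close>

lemma card_mult_le_of_degrees:
  fixes R :: "'a \<Rightarrow> 'b \<Rightarrow> bool"
  assumes "finite X" "finite Y"
    and "\<And>x. x \<in> X \<Longrightarrow> a \<le> card {y \<in> Y. R x y}"
    and "\<And>y. y \<in> Y \<Longrightarrow> card {x \<in> X. R x y} \<le> b"
  shows "card X * a \<le> card Y * b"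
proof -
  have "card X * a \<le> (\<Sum>x\<in>X. card {y \<in> Y. R x y})"
    using sum_bounded_below[of X a] assms(3) by simp
  also have "\<dots> = (\<Sum>y\<in>Y. card {x \<in> X. R x y})"
    using assms(1,2) by (intro sum_multicount_gen) auto
  also have "\<dots> \<le> card Y * b"
    using sum_bounded_above[of Y _ b] assms(4) by simp
  finally show ?thesis .
qed

text \<open>Hall's condition comes from double counting the edges between \<open>J\<close> and its
  neighbourhood \<open>N\<close>: \<open>card J * a\<close> is at most \<open>card N * b\<close>,
  hence at most \<open>card N * a\<close>.\<close>

lemma matching_of_degrees:
  fixes R :: "'a \<Rightarrow> 'b \<Rightarrow> bool"
  assumes "finite X" "finite Y" and "b < a"
    and "\<And>x. x \<in> X \<Longrightarrow> a \<le> card {y \<in> Y. R x y}"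
    and "\<And>y. y \<in> Y \<Longrightarrow> card {x \<in> X. R x y} \<le> b"
  obtains f where "inj_on f X" "\<And>x. x \<in> X \<Longrightarrow> f x \<in> Y \<and> R x (f x)"
proof -
  have "card J \<le> card (\<Union>x\<in>J. {y \<in> Y. R x y})" if J: "J \<subseteq> X" for J
  proof -
    let ?N = "\<Union>x\<in>J. {y \<in> Y. R x y}"
    have "card J * a \<le> card ?N * b"
    proof (rule card_mult_le_of_degrees[where R = R])
      show "finite J" using J assms(1) by (rule finite_subset)
      show "finite ?N" using assms(2) by (rule rev_finite_subset) auto
      show "a \<le> card {y \<in> ?N. R x y}" if "x \<in> J" for x
      proof -
        have "{y \<in> ?N. R x y} = {y \<in> Y. R x y}" using that by auto
        then show ?thesis using assms(4) that J by auto
      qed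
      show "card {x \<in> J. R x y} \<le> b" if "y \<in> ?N" for y
      proof -
        have "card {x \<in> J. R x y} \<le> card {x \<in> X. R x y}"
          using J assms(1) by (intro card_mono) auto
        then show ?thesis using assms(5)[of y] that by auto
      qed
    qed
    also have "\<dots> \<le> card ?N * a" using \<open>b < a\<close> by simp
    finally show ?thesis using \<open>b < a\<close> by simp
  qed
  then obtain f where "inj_on f X" "\<forall>x\<in>X. f x \<in> {y \<in> Y. R x y}"
    using hall_marriage[of X "\<lambda>x. {y \<in> Y. R x y}"] assms(1,2) by auto
  then show ?thesis using that by auto
qed

section \<open>Pushing a family towards the middle level\<close>

text \<open>For strict inclusion this is freeness from \<open>V_poset k\<close> and
  \<open>Lambda_poset l\<close>: embeddings need not reflect the order, so only the numbers of
  larger and smaller members matter.\<close>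

definition bounded_degrees :: "('a \<Rightarrow> 'a \<Rightarrow> bool) \<Rightarrow> nat \<Rightarrow> nat \<Rightarrow> 'a set \<Rightarrow> bool" where
  "bounded_degrees lt k l F \<longleftrightarrow>
     (\<forall>x\<in>F. card {y \<in> F. lt x y} < k \<and> card {y \<in> F. lt y x} < l)"

lemma bounded_degrees_dual:
  "bounded_degrees (\<lambda>x y. lt y x) l k F \<longleftrightarrow> bounded_degrees lt k l F"
  by (auto simp: bounded_degrees_def)

text \<open>The order is kept abstract so that the pushing argument can be used a second time for
  the reversed order, ranked by codimension.\<close>

locale ranked_order =
  fixes S :: "'a set" and lt :: "'a \<Rightarrow> 'a \<Rightarrow> bool" and rk :: "'a \<Rightarrow> nat" and m D d :: nat
  assumes finite_S: "finite S"
    and lt_trans: "lt x y \<Longrightarrow> lt y z \<Longrightarrow> lt x z"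
    and rk_less: "x \<in> S \<Longrightarrow> y \<in> S \<Longrightarrow> lt x y \<Longrightarrow> rk x < rk y"
    and up_degree: "x \<in> S \<Longrightarrow> rk x < m \<Longrightarrow> D \<le> card {y \<in> S. lt x y \<and> rk y = Suc (rk x)}"
    and down_degree: "y \<in> S \<Longrightarrow> rk y \<le> m \<Longrightarrow> card {x \<in> S. lt x y \<and> Suc (rk x) = rk y} \<le> d"
begin

text \<open>Among the at least \<open>D\<close> upper covers of a bottom member, fewer than
  \<open>k\<close> lie in \<open>F\<close>, so at least \<open>d + 1\<close> are free; each free one
  covers at most \<open>d\<close> bottom members. The conclusions on higher levels and on the gap
  serve to trace uniqueness back to \<open>F\<close>.\<close>

lemma push_level:
  assumes F: "F \<subseteq> S" "bounded_degrees lt k l F" and "d + k \<le> D"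
    and "i < m" and low: "\<And>x. x \<in> F \<Longrightarrow> i \<le> rk x"
  obtains G where "G \<subseteq> S" "card G = card F" "bounded_degrees lt k l G"
    "\<forall>x\<in>G. Suc i \<le> rk x"
    "{x \<in> G. Suc i < rk x} = {x \<in> F. Suc i < rk x}"
    "{x \<in> F. i < rk x} \<subseteq> G"
    "(\<exists>x\<in>F. rk x = i) \<longrightarrow> (\<exists>x\<in>G. rk x = Suc i) \<and> (\<exists>y\<in>S - G. rk y = Suc i)"
proof -
  define A where "A = {x \<in> F. rk x = i}"
  \<comment> \<open>Targets avoid \<open>F\<close>, so moved members never collide with those that
    stay.\<close>
  define N where "N = {y \<in> S - F. rk y = Suc i}"
  have finF: "finite F" using F(1) finite_S by (rule finite_subset)
  have finA: "finite A" and finN: "finite N"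
    using finF finite_S by (auto simp: A_def N_def)
  have deg: "Suc d \<le> card {y \<in> N. lt x y}" if x: "x \<in> A" for x
  proof -
    let ?U = "{y \<in> S. lt x y \<and> rk y = Suc (rk x)}"
    have "D \<le> card ?U" using x F(1) \<open>i < m\<close> by (intro up_degree) (auto simp: A_def)
    also have "\<dots> \<le> card ({y \<in> N. lt x y} \<union> {y \<in> F. lt x y})"
      using x finN finF by (intro card_mono finite_UnI finite_Collect_conjI) (auto simp: A_def N_def)
    also have "\<dots> \<le> card {y \<in> N. lt x y} + card {y \<in> F. lt x y}" by (rule card_Un_le)
    finally have "D \<le> card {y \<in> N. lt x y} + card {y \<in> F. lt x y}" .
    moreover have "card {y \<in> F. lt x y} < k"
      using F(2) x by (auto simp: bounded_degrees_def A_def)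
    ultimately show ?thesis using \<open>d + k \<le> D\<close> by simp
  qed
  have codeg: "card {x \<in> A. lt x y} \<le> d" if y: "y \<in> N" for y
  proof -
    have "card {x \<in> A. lt x y} \<le> card {x \<in> S. lt x y \<and> Suc (rk x) = rk y}"
      using y finite_S F(1) by (intro card_mono) (auto simp: A_def N_def)
    also have "\<dots> \<le> d" using y \<open>i < m\<close> by (intro down_degree) (auto simp: N_def)
    finally show ?thesis .
  qed
  obtain f where f_inj: "inj_on f A" and f: "\<And>x. x \<in> A \<Longrightarrow> f x \<in> N \<and> lt x (f x)"
    using matching_of_degrees[of A N d "Suc d" lt] finA finN deg codeg by auto
  define h where "h = (\<lambda>x. if x \<in> A then f x else x)"
  define G where "G = h ` F"
  have G: "G = (F - A) \<union> f ` A" by (auto simp: G_def h_def A_def)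
  have rkF: "rk x = i" if "x \<in> A" for x using that by (simp add: A_def)
  have rkF': "Suc i \<le> rk x" if "x \<in> F - A" for x
    using that low[of x] by (auto simp: A_def)
  have rkf: "rk (f x) = Suc i" "f x \<in> S" "f x \<notin> F" if "x \<in> A" for x
    using f[OF that] by (auto simp: N_def)
  have GS: "G \<subseteq> S" using F(1) rkf(2) by (auto simp: G)
  have lowG: "Suc i \<le> rk x" if "x \<in> G" for x
    using that rkF' rkf(1) by (auto simp: G)
  have h_inj: "inj_on h F"
  proof (rule inj_onI)
    fix x y assume xy: "x \<in> F" "y \<in> F" "h x = h y"
    consider "x \<in> A" "y \<in> A" | "x \<notin> A" "y \<notin> A" | "x \<in> A" "y \<notin> A" | "x \<notin> A" "y \<in> A"
      by blast
    then show "x = y"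
      using xy rkf(3)[of x] rkf(3)[of y] inj_onD[OF f_inj, of x y] by cases (auto simp: h_def)
  qed
  have "bounded_degrees lt k l G"
    unfolding bounded_degrees_def
  proof (intro ballI)
    fix y assume yG: "y \<in> G"
    show "card {z \<in> G. lt y z} < k \<and> card {z \<in> G. lt z y} < l"
    proof (cases "y \<in> F - A")
      case True
      \<comment> \<open>Moved members land on level \<open>Suc i\<close>, which is not above the
        level of \<open>y\<close>.\<close>
      have "\<not> lt y (f x)" if "x \<in> A" for x
        using rk_less[of y "f x"] rkF'[OF True] rkf[OF that] GS yG by auto
      then have "{z \<in> G. lt y z} \<subseteq> {z \<in> F. lt y z}" by (auto simp: G)
      then have "card {z \<in> G. lt y z} \<le> card {z \<in> F. lt y z}"
        using finF by (intro card_mono) auto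
      \<comment> \<open>Moving members up creates no new member below \<open>y\<close>: if \<open>y\<close> lies above \<open>f x\<close>, then it
        lay above \<open>x\<close>.\<close>
      moreover have "lt x y" if "lt (h x) y" for x
        using that f[of x] lt_trans[of x "f x" y] by (auto simp: h_def split: if_splits)
      then have "{z \<in> G. lt z y} \<subseteq> h ` {z \<in> F. lt z y}" by (auto simp: G_def)
      then have "card {z \<in> G. lt z y} \<le> card {z \<in> F. lt z y}"
        using finF by (intro surj_card_le) auto
      moreover have "card {z \<in> F. lt y z} < k" "card {z \<in> F. lt z y} < l"
        using F(2) True by (auto simp: bounded_degrees_def)
      ultimately show ?thesis by linarith
    next
      case False
      then obtain x where x: "x \<in> A" "y = f x" using yG by (auto simp: G)
      have xF: "x \<in> F" using x by (simp add: A_def)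
      have "\<not> lt y (f x')" if "x' \<in> A" for x'
        using rk_less[of y "f x'"] rkf[OF that] rkf[OF x(1)] x(2) by auto
      \<comment> \<open>A moved member inherits the upper bound of its origin \<open>x\<close>.
        Nothing lies below it, since it is now on the lowest level.\<close>
      then have "{z \<in> G. lt y z} \<subseteq> {z \<in> F. lt x z}"
        using lt_trans[OF conjunct2[OF f[OF x(1)]]] x(2) by (auto simp: G)
      then have "card {z \<in> G. lt y z} \<le> card {z \<in> F. lt x z}"
        using finF by (intro card_mono) auto
      moreover have "{z \<in> G. lt z y} = {}"
      proof -
        have False if "z \<in> G" "lt z y" for z
          using rk_less[of z y] lowG[of z] rkf[OF x(1)] x(2) GS that by auto
        then show ?thesis by blast
      qed
      then have "card {z \<in> G. lt z y} = 0" by (simp only: card.empty)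
      \<comment> \<open>Positivity of \<open>l\<close> follows from the strict bound that
        \<open>x\<close>, as a member of \<open>F\<close>, satisfies.\<close>
      moreover have "card {z \<in> F. lt x z} < k" "0 < l"
        using F(2) xF by (auto simp: bounded_degrees_def)
      ultimately show ?thesis by linarith
    qed
  qed
  moreover have "card G = card F" unfolding G_def using h_inj by (rule card_image)
  moreover have "{x \<in> G. Suc i < rk x} = {x \<in> F. Suc i < rk x}"
    using rkf(1) rkF by (auto simp: G)
  moreover have "{x \<in> F. i < rk x} \<subseteq> G" by (auto simp: G A_def)
  moreover have "(\<exists>x\<in>G. rk x = Suc i) \<and> (\<exists>y\<in>S - G. rk y = Suc i)" if "\<exists>x\<in>F. rk x = i"
  proof
    from that obtain x where x: "x \<in> A" by (auto simp: A_def)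
    then show "\<exists>x\<in>G. rk x = Suc i" using rkf(1) by (auto simp: G)
    have "card A * d < card A * Suc d" using x finA by (auto simp: card_gt_0_iff)
    also have "\<dots> \<le> card N * d"
      using finA finN deg codeg by (rule card_mult_le_of_degrees)
    finally have "card A < card N" by simp
    then have "\<not> N \<subseteq> f ` A"
      using card_mono[of "f ` A" N] card_image[OF f_inj] finA by (metis finite_imageI not_less)
    then show "\<exists>y\<in>S - G. rk y = Suc i" by (auto simp: N_def G)
  qed
  ultimately show ?thesis using GS lowG by (intro that[of G]) simp_all
qed

text \<open>A nonempty level below the middle passes its members on to the next level, so the last
  push into level \<open>m\<close> also moves something and leaves the gap there.\<close>

lemma push_to_middle:
  assumes "F \<subseteq> S" "bounded_degrees lt k l F" and "d + k \<le> D"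
  obtains G where "G \<subseteq> S" "card G = card F" "bounded_degrees lt k l G"
    "\<forall>x\<in>G. m \<le> rk x"
    "{x \<in> G. m < rk x} = {x \<in> F. m < rk x}"
    "(\<exists>x\<in>F. rk x < m) \<longrightarrow> (\<exists>y\<in>S - G. rk y = m)"
proof -
  \<comment> \<open>The starting level \<open>i\<close> is generalised, and the induction runs from
    \<open>m\<close> down to 0.\<close>
  have push: "\<exists>G \<subseteq> S. card G = card F \<and> bounded_degrees lt k l G \<and> (\<forall>x\<in>G. m \<le> rk x) \<and>
      {x \<in> G. m < rk x} = {x \<in> F. m < rk x} \<and> ((\<exists>x\<in>F. rk x < m) \<longrightarrow> (\<exists>y\<in>S - G. rk y = m))"
    if "i \<le> m" "F \<subseteq> S" "bounded_degrees lt k l F" "\<forall>x\<in>F. i \<le> rk x" for i F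
    using that
  proof (induction i arbitrary: F rule: inc_induct)
    case base
    then show ?case by (intro exI[of _ F]) auto
  next
    case (step i)
    obtain F' where F': "F' \<subseteq> S" "card F' = card F" "bounded_degrees lt k l F'"
      "\<forall>x\<in>F'. Suc i \<le> rk x"
      "{x \<in> F'. Suc i < rk x} = {x \<in> F. Suc i < rk x}"
      "{x \<in> F. i < rk x} \<subseteq> F'"
      "(\<exists>x\<in>F. rk x = i) \<longrightarrow> (\<exists>x\<in>F'. rk x = Suc i) \<and> (\<exists>y\<in>S - F'. rk y = Suc i)"
      by (rule push_level[OF step.prems(1,2) \<open>d + k \<le> D\<close> step.hyps(2) bspec[OF step.prems(3)]])
    show ?case
    proof (cases "Suc i = m")
      case True
      have "\<exists>y\<in>S - F'. rk y = m" if "\<exists>x\<in>F. rk x < m"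
      proof -
        from that obtain x where "x \<in> F" "rk x < m" by blast
        moreover have "i \<le> rk x" using \<open>x \<in> F\<close> step.prems(3) by blast
        ultimately have "rk x = i" using True by linarith
        then show ?thesis using F'(7) \<open>x \<in> F\<close> True by blast
      qed
      moreover have "\<forall>x\<in>F'. m \<le> rk x" using F'(4) True by simp
      ultimately show ?thesis
        using F'(1-3) F'(5)[unfolded True] by (intro exI[of _ F'] conjI impI) simp_all
    next
      case False
      then have less: "Suc i < m" using step.hyps by simp
      obtain G where G: "G \<subseteq> S" "card G = card F'" "bounded_degrees lt k l G"
        "\<forall>x\<in>G. m \<le> rk x" "{x \<in> G. m < rk x} = {x \<in> F'. m < rk x}"
        "(\<exists>x\<in>F'. rk x < m) \<longrightarrow> (\<exists>y\<in>S - G. rk y = m)"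
        using step.IH[OF F'(1,3,4)] by (elim exE conjE) (rule that)
      have eq: "{x \<in> F'. m < rk x} = {x \<in> F. m < rk x}"
      proof (rule Collect_cong)
        fix x show "x \<in> F' \<and> m < rk x \<longleftrightarrow> x \<in> F \<and> m < rk x"
          using eqset_imp_iff[OF F'(5), of x] less by auto
      qed
      \<comment> \<open>A witness on level \<open>i\<close> yields one on level
        \<open>Suc i\<close>, still below \<open>m\<close>; a higher witness was not moved.\<close>
      have "\<exists>x\<in>F'. rk x < m" if "\<exists>x\<in>F. rk x < m"
      proof -
        from that obtain x where x: "x \<in> F" "rk x < m" by blast
        show ?thesis
        proof (cases "rk x = i")
          case True
          then obtain y where "y \<in> F'" "rk y = Suc i" using F'(7) x(1) by blast
          then show ?thesis using less by (intro bexI[of _ y]) simp_all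
        next
          case False
          moreover have "i \<le> rk x" using step.prems(3) x(1) by blast
          ultimately have "i < rk x" by linarith
          then show ?thesis using F'(6) x by blast
        qed
      qed
      then have "(\<exists>x\<in>F. rk x < m) \<longrightarrow> (\<exists>y\<in>S - G. rk y = m)"
        using G(6) by blast
      then show ?thesis
        by (intro exI[of _ G] conjI G(1,3,4) trans[OF G(2) F'(2)] trans[OF G(5) eq])
    qed
  qed
  show ?thesis
    by (rule push[OF le0 assms(1,2), THEN exE]) (simp, elim conjE, rule that)
qed

end

section \<open>Pushing from both sides: upper bound and uniqueness\<close>

text \<open>Pushing up and then down maps \<open>F\<close> to an equally large subset of the middle
  level. If that subset is the whole level, there is no gap, so neither push moved anything.\<close>

lemma bounded_degrees_card_le:
  assumes "ranked_order S lt rk m D d"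
    and "ranked_order S (\<lambda>x y. lt y x) (\<lambda>x. n - rk x) m D d"
    and "n = 2 * m" and rk_le: "\<And>x. x \<in> S \<Longrightarrow> rk x \<le> n"
    and "d + k \<le> D" "d + l \<le> D"
    and F: "F \<subseteq> S" "bounded_degrees lt k l F"
  shows "card F \<le> card {x \<in> S. rk x = m}"
    and "card F = card {x \<in> S. rk x = m} \<Longrightarrow> F = {x \<in> S. rk x = m}"
proof -
  let ?M = "{x \<in> S. rk x = m}"
  interpret up: ranked_order S lt rk m D d by fact
  interpret down: ranked_order S "\<lambda>x y. lt y x" "\<lambda>x. n - rk x" m D d by fact
  have finM: "finite ?M" using up.finite_S by simp
  obtain G where G: "G \<subseteq> S" "card G = card F" "bounded_degrees lt k l G"
    "\<forall>x\<in>G. m \<le> rk x"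
    "{x \<in> G. m < rk x} = {x \<in> F. m < rk x}"
    "(\<exists>x\<in>F. rk x < m) \<longrightarrow> (\<exists>y\<in>S - G. rk y = m)"
    by (rule up.push_to_middle[OF F \<open>d + k \<le> D\<close>])
  \<comment> \<open>Reversal swaps the two bounds, so the second push needs \<open>l\<close> in
    place of \<open>k\<close>.\<close>
  have G_dual: "bounded_degrees (\<lambda>x y. lt y x) l k G"
    using G(3) by (rule iffD2[OF bounded_degrees_dual])
  obtain H where H: "H \<subseteq> S" "card H = card G"
    "bounded_degrees (\<lambda>x y. lt y x) l k H"
    "\<forall>x\<in>H. m \<le> n - rk x"
    "{x \<in> H. m < n - rk x} = {x \<in> G. m < n - rk x}"
    "(\<exists>x\<in>G. n - rk x < m) \<longrightarrow> (\<exists>y\<in>S - H. n - rk y = m)"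
    by (rule down.push_to_middle[OF G(1) G_dual \<open>d + l \<le> D\<close>])
  have midH: "rk x = m" if "x \<in> H" for x
  proof -
    have "m \<le> n - rk x" using H(4) that by blast
    \<comment> \<open>The downward push leaves the part below the middle unchanged, and
      \<open>G\<close> has no such part.\<close>
    moreover have "\<not> m < n - rk x"
    proof
      assume "m < n - rk x"
      then have "x \<in> G" using eqset_imp_iff[OF H(5), of x] that by simp
      then have "m \<le> rk x" using G(4) by blast
      with \<open>m < n - rk x\<close> \<open>n = 2 * m\<close> show False by linarith
    qed
    moreover have "rk x \<le> n" using H(1) that by (intro rk_le) auto
    ultimately show ?thesis using \<open>n = 2 * m\<close> by linarith
  qed
  then have HM: "H \<subseteq> ?M" using H(1) by auto
  show "card F \<le> card ?M"
    using card_mono[OF finM HM] H(2) G(2) by simp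
  assume "card F = card ?M"
  then have HM': "H = ?M" using card_subset_eq[OF finM HM] H(2) G(2) by simp
  \<comment> \<open>A member of \<open>G\<close> above the middle would force a gap in
    \<open>H\<close>, which is the full middle level.\<close>
  have "rk x = m" if "x \<in> G" for x
  proof (rule ccontr)
    assume "rk x \<noteq> m"
    moreover have "m \<le> rk x" "rk x \<le> n" using G(1,4) that by (auto intro: rk_le)
    ultimately have "n - rk x < m" using \<open>n = 2 * m\<close> by linarith
    then have "\<exists>y\<in>S - H. n - rk y = m" using H(6) \<open>x \<in> G\<close> by blast
    then obtain y where y: "y \<in> S - H" "n - rk y = m" by blast
    then have "rk y = m" using rk_le[of y] \<open>n = 2 * m\<close> by simp
    with y(1) HM' show False by simp
  qed
  then have GM: "G \<subseteq> ?M" and "{x \<in> G. m < rk x} = {}" using G(1) by auto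
  have GM': "G = ?M"
    using card_subset_eq[OF finM GM] \<open>card F = card ?M\<close> G(2) by simp
  \<comment> \<open>The same argument for the first push, now that \<open>G\<close> is the full
    middle level.\<close>
  have "rk x = m" if "x \<in> F" for x
  proof -
    have "\<not> m < rk x"
      using eqset_imp_iff[OF G(5), of x] \<open>{x \<in> G. m < rk x} = {}\<close> that by simp
    moreover have "\<not> rk x < m" using G(6) GM' that by blast
    ultimately show ?thesis by simp
  qed
  then have "F \<subseteq> ?M" using F(1) by auto
  then show "F = ?M"
    using card_subset_eq[OF finM] \<open>card F = card ?M\<close> by simp
qed

section \<open>Counting subspaces over a finite field\<close>

text \<open>This recursion in \<open>k\<close> has the shape that double counting of covering pairs
  produces.\<close>

lemma gaussian_binomial_Suc:
  assumes "k < n" and "2 \<le> q"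
  shows "gaussian_binomial q n (Suc k) * (real q ^ Suc k - 1) =
    gaussian_binomial q n k * (real q ^ (n - k) - 1)"
proof -
  \<comment> \<open>Reversing the product makes the denominators for \<open>k\<close> and
    \<open>Suc k\<close> differ by a single factor.\<close>
  have denom: "(\<Prod>i<j. real q ^ (j - i) - 1) = (\<Prod>i<j. real q ^ Suc i - 1)" for j
    by (rule prod.reindex_bij_witness[of _ "\<lambda>i. j - Suc i" "\<lambda>i. j - Suc i"]) (auto simp: Suc_diff_Suc)
  have "real q ^ Suc i - 1 \<noteq> 0" for i
    using assms(2) power_gt1[of "real q" i] by simp
  then show ?thesis
    by (simp add: gaussian_binomial_def prod_dividef denom del: power_Suc)
qed

lemma gaussian_binomial_self: "2 \<le> q \<Longrightarrow> gaussian_binomial q n n = 1"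
proof -
  assume q: "2 \<le> q"
  have "real q ^ (n - i) - 1 \<noteq> 0" if "i < n" for i
    using q that one_less_power[of "real q" "n - i"] by (intro less_imp_neq[THEN not_sym]) simp
  then show ?thesis by (simp add: gaussian_binomial_def)
qed

lemma nat_geometric_sum: "1 \<le> q \<Longrightarrow> (q - 1) * (\<Sum>i<n. q ^ i) + 1 = (q ^ n :: nat)"
  by (cases q; induction n) (auto simp: algebra_simps)

lemma real_geometric_sum: "(real q - 1) * real (\<Sum>i<n. q ^ i) = real q ^ n - 1"
  using power_diff_1_eq[of "real q" n] by simp

lemma finite_set_of_sets:
  fixes F :: "'a set set"
  assumes "finite (UNIV :: 'a set)"
  shows "finite F"
proof -
  have "finite (Pow (UNIV :: 'a set))" using assms by (simp only: finite_Pow_iff)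
  then show ?thesis by (rule rev_finite_subset) (simp only: Pow_UNIV subset_UNIV)
qed

context finite_dimensional_vector_space
begin

text \<open>Every vector of the larger span is \<open>c *s a + s\<close> for a unique scalar
  \<open>c\<close> and a unique \<open>s\<close> in \<open>span S\<close>.\<close>

lemma card_span_insert:
  assumes "a \<notin> span S"
  shows "card (span (insert a S)) = CARD('a) * card (span S)"
proof -
  have "bij_betw (\<lambda>(c, s). c *s a + s) (UNIV \<times> span S) (span (insert a S))"
    unfolding bij_betw_def
  proof
    have "c = c' \<and> s = s'"
      if "s \<in> span S" "s' \<in> span S" "c *s a + s = c' *s a + s'" for c c' s s'
    proof -
      have "(c - c') *s a = s' - s"
        using that(3) by (simp add: scale_left_diff_distrib algebra_simps)
      then have mem: "(c - c') *s a \<in> span S" using that(1,2) by (simp add: span_diff)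
      have "c = c'"
      proof (rule ccontr)
        assume "c \<noteq> c'"
        then have "a \<in> span S" using span_scale[OF mem, of "inverse (c - c')"] by simp
        then show False using assms by simp
      qed
      then show ?thesis using that(3) by simp
    qed
    then show "inj_on (\<lambda>(c, s). c *s a + s) (UNIV \<times> span S)"
      by (auto simp: inj_on_def)
    show "(\<lambda>(c, s). c *s a + s) ` (UNIV \<times> span S) = span (insert a S)"
    proof (intro equalityI subsetI)
      fix x assume "x \<in> (\<lambda>(c, s). c *s a + s) ` (UNIV \<times> span S)"
      then obtain c s where "x = c *s a + s" "s \<in> span S" by auto
      then have "x - c *s a \<in> span S" by simp
      then show "x \<in> span (insert a S)" by (auto simp: span_breakdown_eq)
    next
      fix x assume "x \<in> span (insert a S)"
      then obtain c where "x - c *s a \<in> span S" by (auto simp: span_breakdown_eq)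
      then show "x \<in> (\<lambda>(c, s). c *s a + s) ` (UNIV \<times> span S)"
        by (intro image_eqI[of _ _ "(c, x - c *s a)"]) auto
    qed
  qed
  then show ?thesis
    by (simp add: bij_betw_same_card[symmetric] card_cartesian_product)
qed

lemma card_subspace:
  assumes "subspace U"
  shows "card U = CARD('a) ^ dim U"
proof -
  have "card (span B) = CARD('a) ^ card B" if "finite B" "independent B" for B
    using that
  proof (induction B rule: finite_induct)
    case (insert a B)
    then show ?case by (simp add: card_span_insert independent_insert)
  qed simp
  moreover obtain B where "independent B" "span B = U" "card B = dim U"
    using basis_exists[of U] assms by (metis span_subspace)
  ultimately show ?thesis using finiteI_independent by metis
qed

lemma finite_UNIV_vectors:
  assumes "finite (UNIV :: 'a set)"
  shows "finite (UNIV :: 'b set)"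
proof -
  \<comment> \<open>Infinite sets have \<open>card\<close> 0, so a positive power of the field size
    proves finiteness.\<close>
  have "CARD('b) > 0"
    using card_subspace[of UNIV] assms by (simp add: card_gt_0_iff)
  then show ?thesis by (rule card_ge_0_finite)
qed

lemma dim_insert_subspace:
  "subspace U \<Longrightarrow> v \<notin> U \<Longrightarrow> dim (insert v U) = Suc (dim U)"
  by (simp add: dim_insert span_eq_iff[THEN iffD2])

text \<open>Each vector of \<open>W - U\<close> lies in exactly one cover, its span with
  \<open>U\<close>, and each cover contains \<open>q^(dim U + 1) - q^(dim U)\<close> such vectors,
  where \<open>q\<close> is the field size.\<close>

lemma card_upper_covers:
  assumes fin: "finite (UNIV :: 'a set)" and U: "subspace U" and W: "subspace W" "U \<subseteq> W"
  shows "card {U'. subspace U' \<and> U \<subset> U' \<and> U' \<subseteq> W \<and> dim U' = Suc (dim U)} =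
    (\<Sum>i<dim W - dim U. CARD('a) ^ i)"
proof -
  let ?q = "CARD('a)"
  let ?A = "{U'. subspace U' \<and> U \<subset> U' \<and> U' \<subseteq> W \<and> dim U' = Suc (dim U)}"
  have finV: "finite (X :: 'b set)" for X using finite_UNIV_vectors[OF fin] by (rule finite_subset[rotated]) simp
  have finA: "finite ?A"
    by (rule finite_subset[of _ "Pow W"]) (auto simp: finV)
  have q: "2 \<le> ?q"
    using card_mono[OF fin, of "{0, 1}"] by simp
  have dims: "dim U \<le> dim W" using W(2) by (rule dim_subset)
  have one: "card {U' \<in> ?A. v \<in> U'} = 1" if v: "v \<in> W - U" for v
  proof -
    have span_v: "subspace (span (insert v U))" "span (insert v U) \<subseteq> W" "U \<subseteq> span (insert v U)"
      "v \<in> span (insert v U)" "dim (span (insert v U)) = Suc (dim U)"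
      using v W by (auto simp: span_minimal span_base dim_insert_subspace[OF U])
    moreover have "U' = span (insert v U)" if "U' \<in> ?A" "v \<in> U'" for U'
    proof (rule subspace_dim_equal[symmetric])
      show "span (insert v U) \<subseteq> U'" using that by (intro span_minimal) auto
    qed (use that span_v in auto)
    ultimately have "{U' \<in> ?A. v \<in> U'} = {span (insert v U)}" using v by blast
    then show ?thesis by simp
  qed
  have "(\<Sum>U'\<in>?A. card {v \<in> W - U. v \<in> U'}) = 1 * card (W - U)"
    using finA finV one by (intro sum_multicount) auto
  moreover have "card {v \<in> W - U. v \<in> U'} = ?q ^ Suc (dim U) - ?q ^ dim U" if "U' \<in> ?A" for U'
  proof -
    have "{v \<in> W - U. v \<in> U'} = U' - U" using that by auto
    then show ?thesis
      using that U by (auto simp: card_Diff_subset finV card_subspace)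
  qed
  moreover have "card (W - U) = ?q ^ dim W - ?q ^ dim U"
    using U W by (simp add: card_Diff_subset finV card_subspace)
  ultimately have "card ?A * (?q ^ Suc (dim U) - ?q ^ dim U) = ?q ^ dim W - ?q ^ dim U"
    by simp
  also have "?q ^ Suc (dim U) - ?q ^ dim U = ?q ^ dim U * (?q - 1)"
    by (simp add: algebra_simps)
  also have "?q ^ dim W - ?q ^ dim U = ?q ^ dim U * (?q ^ (dim W - dim U) - 1)"
    using dims by (simp add: diff_mult_distrib2 flip: power_add)
  also have "?q ^ (dim W - dim U) - 1 = (?q - 1) * (\<Sum>i<dim W - dim U. ?q ^ i)"
    using nat_geometric_sum[of ?q "dim W - dim U"] q by simp
  finally show ?thesis using q by simp
qed

text \<open>Double counting of nested pairs of dimensions \<open>j\<close> and \<open>Suc j\<close>.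
  The lower degree is a parameter \<open>c\<close> because its value is established only later, with
  the help of this count.\<close>

lemma count_subspaces_step:
  assumes fin: "finite (UNIV :: 'a set)" and W: "subspace W" and "j < dim W"
    and covers: "\<And>U'. subspace U' \<Longrightarrow> U' \<subseteq> W \<Longrightarrow> dim U' = Suc j \<Longrightarrow>
      card {U. subspace U \<and> U \<subset> U' \<and> dim U = j} = c"
  shows "card {U. subspace U \<and> U \<subseteq> W \<and> dim U = j} * (\<Sum>i<dim W - j. CARD('a) ^ i) =
    c * card {U. subspace U \<and> U \<subseteq> W \<and> dim U = Suc j}"
proof -
  let ?N = "\<lambda>j. {U. subspace U \<and> U \<subseteq> W \<and> dim U = j}"
  have finV: "finite (X :: 'b set)" for X using finite_UNIV_vectors[OF fin] by (rule finite_subset[rotated]) simp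
  have finN: "finite (?N j)" for j
    by (rule finite_subset[of _ "Pow W"]) (auto simp: finV)
  have "(\<Sum>U\<in>?N j. card {U' \<in> ?N (Suc j). U \<subset> U'}) = c * card (?N (Suc j))"
  proof (rule sum_multicount)
    show "\<forall>U'\<in>?N (Suc j). card {U \<in> ?N j. U \<subset> U'} = c"
    proof
      fix U' assume U': "U' \<in> ?N (Suc j)"
      then have "{U \<in> ?N j. U \<subset> U'} = {U. subspace U \<and> U \<subset> U' \<and> dim U = j}" by auto
      then show "card {U \<in> ?N j. U \<subset> U'} = c" using covers U' by simp
    qed
  qed (use finN in auto)
  moreover have "card {U' \<in> ?N (Suc j). U \<subset> U'} = (\<Sum>i<dim W - j. CARD('a) ^ i)"
    if U: "U \<in> ?N j" for U
  proof -
    have "{U' \<in> ?N (Suc j). U \<subset> U'} =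
        {U'. subspace U' \<and> U \<subset> U' \<and> U' \<subseteq> W \<and> dim U' = Suc (dim U)}" using U by auto
    then show ?thesis using card_upper_covers[OF fin _ W, of U] U by simp
  qed
  ultimately show ?thesis by simp
qed

text \<open>Only hyperplane counts below level \<open>m\<close> are assumed. This lets the count of
  hyperplanes itself be derived from this lemma by strong induction.\<close>

lemma card_subspaces_of_dim_aux:
  assumes fin: "finite (UNIV :: 'a set)" and W: "subspace W" and "j \<le> m" "m \<le> dim W"
    and covers: "\<And>U i. subspace U \<Longrightarrow> dim U = Suc i \<Longrightarrow> i < m \<Longrightarrow>
      card {H. subspace H \<and> H \<subset> U \<and> dim H = i} = (\<Sum>t<Suc i. CARD('a) ^ t)"
  shows "real (card {U. subspace U \<and> U \<subseteq> W \<and> dim U = j}) = gaussian_binomial (CARD('a)) (dim W) j"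
  using \<open>j \<le> m\<close>
proof (induction j)
  case 0
  have "{U. subspace U \<and> U \<subseteq> W \<and> dim U = 0} = {{0}}"
    using W by (auto simp: subspace_0)
  then show ?case by (simp add: gaussian_binomial_def)
next
  case (Suc j)
  let ?q = "CARD('a)"
  let ?N = "\<lambda>j. card {U. subspace U \<and> U \<subseteq> W \<and> dim U = j}"
  have q: "2 \<le> ?q"
    using card_mono[OF fin, of "{0, 1}"] by simp
  have "?N j * (\<Sum>i<dim W - j. ?q ^ i) = (\<Sum>t<Suc j. ?q ^ t) * ?N (Suc j)"
    using Suc.prems \<open>m \<le> dim W\<close> by (intro count_subspaces_step[OF fin W] covers) auto
  \<comment> \<open>The factor \<open>q - 1\<close> turns both geometric sums into the differences
    in the Gaussian recursion.\<close>
  then have "real (?N j * (\<Sum>i<dim W - j. ?q ^ i)) * (real ?q - 1) =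
      real ((\<Sum>t<Suc j. ?q ^ t) * ?N (Suc j)) * (real ?q - 1)"
    by (simp only:)
  then have "real (?N j) * ((real ?q - 1) * real (\<Sum>i<dim W - j. ?q ^ i)) =
      real (?N (Suc j)) * ((real ?q - 1) * real (\<Sum>t<Suc j. ?q ^ t))"
    by (simp only: of_nat_mult ac_simps)
  then have "real (?N (Suc j)) * (real ?q ^ Suc j - 1) =
      gaussian_binomial ?q (dim W) (Suc j) * (real ?q ^ Suc j - 1)"
    using Suc.IH Suc.prems \<open>m \<le> dim W\<close> gaussian_binomial_Suc[of j "dim W" ?q] q
    by (simp only: real_geometric_sum)
  moreover have "real ?q ^ Suc j - 1 \<noteq> 0" using power_gt1[of "real ?q" j] q by simp
  ultimately show ?case by simp
qed

text \<open>Instead of duality, the hyperplanes are counted as all \<open>d\<close>-dimensional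
  subspaces of \<open>U\<close>, using the statement for smaller \<open>d\<close>.\<close>

lemma card_lower_covers:
  assumes fin: "finite (UNIV :: 'a set)" and "subspace U" "dim U = Suc d"
  shows "card {H. subspace H \<and> H \<subset> U \<and> dim H = d} = (\<Sum>i<Suc d. CARD('a) ^ i)"
  using assms(2,3)
proof (induction d arbitrary: U rule: less_induct)
  case (less d)
  let ?q = "CARD('a)"
  have q: "2 \<le> ?q"
    using card_mono[OF fin, of "{0, 1}"] by simp
  have "{H. subspace H \<and> H \<subset> U \<and> dim H = d} = {H. subspace H \<and> H \<subseteq> U \<and> dim H = d}"
    using less.prems by auto
  then have "real (card {H. subspace H \<and> H \<subset> U \<and> dim H = d}) = gaussian_binomial ?q (Suc d) d"
    using card_subspaces_of_dim_aux[OF fin less.prems(1), of d d] less.IH less.prems(2) by simp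
  \<comment> \<open>The recursion from \<open>d\<close> to \<open>Suc d\<close>, where the top
    coefficient is 1.\<close>
  also have "\<dots> * (real ?q - 1) = real ?q ^ Suc d - 1"
    using gaussian_binomial_Suc[of d "Suc d" ?q] gaussian_binomial_self[of ?q "Suc d"] q by simp
  also have "\<dots> = real (\<Sum>i<Suc d. ?q ^ i) * (real ?q - 1)"
    using real_geometric_sum[of ?q "Suc d"] by (simp only: ac_simps)
  finally have "real (card {H. subspace H \<and> H \<subset> U \<and> dim H = d}) = real (\<Sum>i<Suc d. ?q ^ i)"
    using q by simp
  then show ?case by (simp only: of_nat_eq_iff)
qed

lemma card_subspaces_of_dim:
  assumes "finite (UNIV :: 'a set)" and "subspace W" "j \<le> dim W"
  shows "real (card {U. subspace U \<and> U \<subseteq> W \<and> dim U = j}) = gaussian_binomial (CARD('a)) (dim W) j"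
  using assms card_lower_covers by (intro card_subspaces_of_dim_aux[where m = j]) auto

section \<open>The subspace lattice and its dual as ranked orders\<close>

text \<open>The two degree bounds differ by exactly \<open>q^m\<close>, the room needed for
  \<open>k\<close> and \<open>l\<close>. Reversal exchanges the counts of upper and lower covers,
  both geometric sums, so the same constants serve.\<close>

lemma ranked_order_subspaces:
  fixes m :: nat
  assumes fin: "finite (UNIV :: 'a set)" and n: "dim UNIV = 2 * m"
  defines "S \<equiv> {U. subspace U}"
  shows "ranked_order S (\<subset>) dim m (\<Sum>i<Suc m. CARD('a) ^ i) (\<Sum>i<m. CARD('a) ^ i)" (is ?up)
    and "ranked_order S (\<lambda>U W. W \<subset> U) (\<lambda>U. 2 * m - dim U) m
      (\<Sum>i<Suc m. CARD('a) ^ i) (\<Sum>i<m. CARD('a) ^ i)" (is ?down)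
proof -
  have finS: "finite S" by (rule finite_set_of_sets[OF finite_UNIV_vectors[OF fin]])
  have dim_le: "dim U \<le> 2 * m" for U
    using dim_subset[of U UNIV] n by simp
  have dim_less: "dim U < dim W" if "U \<in> S" "W \<in> S" "U \<subset> W" for U W
    using dim_psubset[of U W] that by (simp add: S_def span_eq_iff[THEN iffD2])
  have mono: "(\<Sum>i<a. CARD('a) ^ i) \<le> (\<Sum>i<b. CARD('a) ^ i)" if "a \<le> b" for a b :: nat
    using that by (intro sum_mono2) auto
  have upper: "card {W \<in> S. U \<subset> W \<and> dim W = Suc (dim U)} = (\<Sum>i<2 * m - dim U. CARD('a) ^ i)"
    if "U \<in> S" for U
    using card_upper_covers[OF fin, of U UNIV] that n by (simp add: S_def)
  have lower: "card {U \<in> S. U \<subset> W \<and> Suc (dim U) = dim W} = (\<Sum>i<dim W. CARD('a) ^ i)"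
    if "W \<in> S" for W
  proof (cases "dim W")
    case (Suc d)
    then show ?thesis using card_lower_covers[OF fin, of W d] that by (simp add: S_def)
  next
    case 0
    then show ?thesis by (simp del: dim_eq_0)
  qed
  show ?up
  proof
    fix U assume U: "U \<in> S" "dim U < m"
    show "(\<Sum>i<Suc m. CARD('a) ^ i) \<le> card {W \<in> S. U \<subset> W \<and> dim W = Suc (dim U)}"
      unfolding upper[OF U(1)] using U(2) by (intro mono) simp
  next
    fix W assume W: "W \<in> S" "dim W \<le> m"
    show "card {U \<in> S. U \<subset> W \<and> Suc (dim U) = dim W} \<le> (\<Sum>i<m. CARD('a) ^ i)"
      unfolding lower[OF W(1)] using W(2) by (rule mono)
  qed (use finS dim_less in auto)
  show ?down
  proof
    fix U assume U: "U \<in> S" "2 * m - dim U < m"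
    then have "{W \<in> S. W \<subset> U \<and> 2 * m - dim W = Suc (2 * m - dim U)} =
        {W \<in> S. W \<subset> U \<and> Suc (dim W) = dim U}"
      using dim_le[of U] by (intro Collect_cong) auto
    then have "card {W \<in> S. W \<subset> U \<and> 2 * m - dim W = Suc (2 * m - dim U)} =
        (\<Sum>i<dim U. CARD('a) ^ i)"
      using lower[OF U(1)] by (simp only:)
    \<comment> \<open>Codimension below \<open>m\<close> means dimension at least
      \<open>Suc m\<close>.\<close>
    then show "(\<Sum>i<Suc m. CARD('a) ^ i) \<le>
        card {W \<in> S. W \<subset> U \<and> 2 * m - dim W = Suc (2 * m - dim U)}"
      using mono[of "Suc m" "dim U"] U(2) by (simp only:)
  next
    fix W assume W: "W \<in> S" "2 * m - dim W \<le> m"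
    have "Suc (2 * m - dim U) = 2 * m - dim W \<longleftrightarrow> dim U = Suc (dim W)" if "U \<in> S" "W \<subset> U" for U
      using dim_less[OF W(1) that] dim_le[of U] by auto
    then have "{U \<in> S. W \<subset> U \<and> Suc (2 * m - dim U) = 2 * m - dim W} =
        {U \<in> S. W \<subset> U \<and> dim U = Suc (dim W)}"
      by (intro Collect_cong) blast
    then have "card {U \<in> S. W \<subset> U \<and> Suc (2 * m - dim U) = 2 * m - dim W} =
        (\<Sum>i<2 * m - dim W. CARD('a) ^ i)"
      using upper[OF W(1)] by (simp only:)
    with mono[OF W(2)]
    show "card {U \<in> S. W \<subset> U \<and> Suc (2 * m - dim U) = 2 * m - dim W} \<le> (\<Sum>i<m. CARD('a) ^ i)"
      by (simp only:)
  next
    fix U W assume "U \<in> S" "W \<in> S" "W \<subset> U"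
    then show "2 * m - dim U < 2 * m - dim W"
      using dim_less[of W U] dim_le[of U] by simp
  qed (use finS in auto)
qed

end

section \<open>Freeness in terms of degrees\<close>

text \<open>The relation \<open>le\<close> is arbitrary so that reverse inclusion can be inserted
  for \<open>Lambda_poset\<close>. Relations among the \<open>k\<close> larger elements do no harm,
  as the copy need not be induced.\<close>

lemma subposet_V_poset_iff:
  assumes "finite F" and refl: "\<And>x. le x x"
  shows "subposet (V_poset k) (relation_of le F) \<longleftrightarrow> (\<exists>x\<in>F. k \<le> card {y \<in> F. le x y \<and> x \<noteq> y})"
proof -
  have Field_F: "Field (relation_of le F) = F"
    using refl by (auto simp: relation_of_def Field_def)
  show ?thesis
  proof
    assume "subposet (V_poset k) (relation_of le F)"
    then obtain \<phi> where inj: "inj_on \<phi> {0..k}" and F: "\<phi> ` {0..k} \<subseteq> F"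
      and mono: "\<forall>(a, b)\<in>V_poset k. (\<phi> a, \<phi> b) \<in> relation_of le F"
      unfolding subposet_def Field_V_poset Field_F by (elim exE conjE) (rule that)
    have "\<phi> ` {1..k} \<subseteq> {y \<in> F. le (\<phi> 0) y \<and> \<phi> 0 \<noteq> y}"
    proof (rule image_subsetI)
      fix i assume i: "i \<in> {1..k}"
      then have "(0, i) \<in> V_poset k" by (simp add: V_poset_def relation_of_def)
      then have "(\<phi> 0, \<phi> i) \<in> relation_of le F" using mono by blast
      moreover have "\<phi> 0 \<noteq> \<phi> i" using inj_onD[OF inj, of 0 i] i by auto
      ultimately show "\<phi> i \<in> {y \<in> F. le (\<phi> 0) y \<and> \<phi> 0 \<noteq> y}" by (auto simp: relation_of_def)
    qed
    then have "card (\<phi> ` {1..k}) \<le> card {y \<in> F. le (\<phi> 0) y \<and> \<phi> 0 \<noteq> y}"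
      using \<open>finite F\<close> by (intro card_mono) auto
    moreover have "card (\<phi> ` {1..k}) = k"
      using inj_on_subset[OF inj, of "{1..k}"] by (simp add: card_image)
    moreover have "\<phi> 0 \<in> F" using F by auto
    ultimately show "\<exists>x\<in>F. k \<le> card {y \<in> F. le x y \<and> x \<noteq> y}"
      by (intro bexI[of _ "\<phi> 0"]) simp_all
  next
    assume "\<exists>x\<in>F. k \<le> card {y \<in> F. le x y \<and> x \<noteq> y}"
    then obtain x where x: "x \<in> F" "k \<le> card {y \<in> F. le x y \<and> x \<noteq> y}" by (elim bexE)
    obtain T where T: "T \<subseteq> {y \<in> F. le x y \<and> x \<noteq> y}" "card T = k" "finite T"
      by (rule obtain_subset_with_card_n[OF x(2)])
    obtain h where h: "bij_betw h {1..k} T"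
      using ex_bij_betw_nat_finite_1[OF T(3)] unfolding T(2) by (elim exE)
    have hT: "h i \<in> F \<and> le x (h i) \<and> x \<noteq> h i" if "0 < i" "i \<le> k" for i
    proof -
      have "h i \<in> T" using bij_betwE[OF h] that by simp
      then show ?thesis using T(1) by blast
    qed
    \<comment> \<open>The bottom element \<open>0\<close> goes to \<open>x\<close>, which differs
      from all of the chosen larger elements.\<close>
    have "inj_on (h(0 := x)) {0..k}"
    proof (rule inj_onI)
      fix i j assume "i \<in> {0..k}" "j \<in> {0..k}" "(h(0 := x)) i = (h(0 := x)) j"
      then show "i = j"
        using hT[of i] hT[of j] inj_onD[OF bij_betw_imp_inj_on[OF h], of i j]
        by (cases "i = 0"; cases "j = 0") auto
    qed
    moreover have "(h(0 := x)) ` {0..k} \<subseteq> F" using hT x(1) by auto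
    moreover have "\<forall>(a, b)\<in>V_poset k. ((h(0 := x)) a, (h(0 := x)) b) \<in> relation_of le F"
      using hT x(1) refl by (auto simp: V_poset_def relation_of_def)
    ultimately show "subposet (V_poset k) (relation_of le F)"
      unfolding subposet_def Field_V_poset Field_F by (intro exI conjI)
  qed
qed

lemma subposet_converse_iff: "subposet (P\<inverse>) Q \<longleftrightarrow> subposet P (Q\<inverse>)"
proof -
  have "(\<forall>(x, y)\<in>P\<inverse>. (\<phi> x, \<phi> y) \<in> Q) \<longleftrightarrow> (\<forall>(x, y)\<in>P. (\<phi> x, \<phi> y) \<in> Q\<inverse>)" for \<phi>
    by auto
  then show ?thesis by (simp only: subposet_def Field_converse)
qed

lemma poset_free_V_Lambda_iff:
  assumes "finite F"
  shows "poset_free {V_poset k, Lambda_poset l} F \<longleftrightarrow> bounded_degrees (\<subset>) k l F"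
proof -
  have "(relation_of (\<subseteq>) F)\<inverse> = relation_of (\<supseteq>) F"
    by (auto simp: relation_of_def)
  then have "subposet (Lambda_poset l) (relation_of (\<subseteq>) F) \<longleftrightarrow>
      (\<exists>x\<in>F. l \<le> card {y \<in> F. y \<subseteq> x \<and> x \<noteq> y})"
    using subposet_V_poset_iff[OF assms, of "(\<supseteq>)" l]
    by (simp add: Lambda_poset_def subposet_converse_iff)
  moreover have "{y \<in> F. y \<subseteq> x \<and> x \<noteq> y} = {y \<in> F. y \<subset> x}"
    "{y \<in> F. x \<subseteq> y \<and> x \<noteq> y} = {y \<in> F. x \<subset> y}" for x
    by auto
  ultimately have "poset_free {V_poset k, Lambda_poset l} F \<longleftrightarrow>
      \<not> ((\<exists>x\<in>F. k \<le> card {y \<in> F. x \<subset> y}) \<or> (\<exists>x\<in>F. l \<le> card {y \<in> F. y \<subset> x}))"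
    using subposet_V_poset_iff[OF assms, of "(\<subseteq>)" k]
    by (simp only: poset_free_def bex_simps subset_refl simp_thms)
  then show ?thesis
    by (simp only: bounded_degrees_def not_le) (simp add: not_le ball_conj_distrib)
qed

section \<open>The extremal number and the unique extremal family\<close>

theorem theorem5:
  fixes q n k l :: nat
    and scale :: "'k::field \<Rightarrow> 'v::ab_group_add \<Rightarrow> 'v"
    and Basis :: "'v set"
  assumes "primepow q"
    and "CARD('k) = q"
    and "finite_dimensional_vector_space scale Basis"
    and "vector_space.dim scale UNIV = n"
    and "even n"
    and "1 \<le> k" and "k \<le> q ^ (n div 2)"
    and "1 \<le> l" and "l \<le> q ^ (n div 2)"
  shows "real (La scale {V_poset k, Lambda_poset l}) = gaussian_binomial q n (n div 2) \<and>
    (\<forall>F. free_subspace_family scale {V_poset k, Lambda_poset l} F \<and>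
         card F = La scale {V_poset k, Lambda_poset l} \<longleftrightarrow>
         F = {U. module.subspace scale U \<and> vector_space.dim scale U = n div 2})"
proof -
  interpret finite_dimensional_vector_space scale Basis by fact
  define m where "m = n div 2"
  have n: "n = 2 * m" using \<open>even n\<close> by (simp add: m_def)
  have "0 < CARD('k)" using \<open>CARD('k) = q\<close> primepow_gt_0_nat[OF \<open>primepow q\<close>] by simp
  then have fin: "finite (UNIV :: 'k set)" by (rule card_ge_0_finite)
  let ?P = "{V_poset k, Lambda_poset l}"
  let ?M = "{U. subspace U \<and> dim U = m}"
  have finF: "finite (F :: 'v set set)" for F by (rule finite_set_of_sets[OF finite_UNIV_vectors[OF fin]])
  have free_iff: "free_subspace_family scale ?P F \<longleftrightarrow>
      F \<subseteq> {U. subspace U} \<and> bounded_degrees (\<subset>) k l F" for F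
    by (auto simp: free_subspace_family_def poset_free_V_Lambda_iff[OF finF])
  have dimV: "dim UNIV = 2 * m" using assms(4) n by simp
  have dim_le: "dim U \<le> 2 * m" for U
    using dim_subset[of U UNIV] dimV by simp
  \<comment> \<open>The sums differ by the single term \<open>q^m\<close>, so this is where the
    upper bounds on \<open>k\<close> and \<open>l\<close> enter.\<close>
  have D: "(\<Sum>i<m. CARD('k) ^ i) + k \<le> (\<Sum>i<Suc m. CARD('k) ^ i)"
    "(\<Sum>i<m. CARD('k) ^ i) + l \<le> (\<Sum>i<Suc m. CARD('k) ^ i)"
    using assms(2,7,9) by (auto simp: m_def)
  have M: "?M = {U \<in> {U. subspace U}. dim U = m}" by simp
  note bound = bounded_degrees_card_le[OF ranked_order_subspaces[OF fin dimV] refl dim_le D,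
      folded M]
  have le: "card F \<le> card ?M" if "free_subspace_family scale ?P F" for F
    using that unfolding free_iff by (elim conjE) (rule bound(1))
  have eq: "F = ?M" if "free_subspace_family scale ?P F" "card F = card ?M" for F
    using that unfolding free_iff by (elim conjE) (rule bound(2))
  \<comment> \<open>The middle level is an antichain: all its degrees are 0, which is below the
    positive \<open>k\<close> and \<open>l\<close>.\<close>
  have "\<not> U \<subset> W" if "U \<in> ?M" "W \<in> ?M" for U W
    using that subspace_dim_equal[of U W] by auto
  then have "card {W \<in> ?M. U \<subset> W} = 0" "card {W \<in> ?M. W \<subset> U} = 0" if "U \<in> ?M" for U
    using that by (metis (no_types, lifting) card.empty Collect_empty_eq)+
  then have "bounded_degrees (\<subset>) k l ?M"
    using \<open>1 \<le> k\<close> \<open>1 \<le> l\<close> unfolding bounded_degrees_def by simp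
  then have free_M: "free_subspace_family scale ?P ?M" by (auto simp: free_iff)
  have La: "La scale ?P = card ?M"
    unfolding La_def
  \<comment> \<open>\<open>Max\<close> is meaningful only for a finite set of sizes, which holds
    because there are finitely many families of sets of vectors.\<close>
  proof (rule Max_eqI)
    have "finite (range (card :: 'v set set \<Rightarrow> nat))"
      by (intro finite_imageI finite_set_of_sets finF)
    then show "finite {card F |F. free_subspace_family scale ?P F}"
      by (rule rev_finite_subset) auto
  qed (use le free_M in auto)
  have "real (card ?M) = gaussian_binomial q n m"
    using card_subspaces_of_dim[OF fin, of UNIV m] dimV n assms(2) by simp
  moreover have "free_subspace_family scale ?P F \<and> card F = card ?M \<longleftrightarrow> F = ?M" for F
    using eq[of F] free_M by blast
  ultimately show ?thesis
    unfolding La m_def[symmetric] by simp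
qed

end
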